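(* For $\omega^*=\beta\omega\setminus\omega$ one has $$Borel(C(\omega^* ),\tau_p)\neq Borel(C(\omega^* ),weak).$$
   Context: $\beta\omega$ is the Čech–Stone compactification of the discrete space $\omega$. For a compact space $K$, $C(K)$ is the Banach space of continuous real-valued functions on $K$ with the supremum norm; $\tau_p$ is the topology of pointwise convergence on $C(K)$ and $weak$ is the weak topology of the Banach space $C(K)$. $Borel(X,\tau)$ is the $\sigma$-algebra generated by the $\tau$-open sets. *)

theory Defs
  imports "HOL-Analysis.Analysis"
begin

section \<open>Ultrafilters\<close>

definition ultrafilter :: "'a filter \<Rightarrow> bool" where
  "ultrafilter F \<longleftrightarrow> F \<noteq> bot \<and> (\<forall>P. eventually P F \<or> eventually (\<lambda>x. \<not> P x) F)"

lemma ultrafilter_not_eventually: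
  assumes "ultrafilter F"
  shows "eventually (\<lambda>x. \<not> P x) F \<longleftrightarrow> \<not> eventually P F"
proof
  assume n: "eventually (\<lambda>x. \<not> P x) F"
  show "\<not> eventually P F"
  proof
    assume "eventually P F"
    with n have "eventually (\<lambda>x. False) F"
      by eventually_elim simp
    with assms show False
      by (simp add: ultrafilter_def trivial_limit_def)
  qed
next
  assume "\<not> eventually P F"
  with assms show "eventually (\<lambda>x. \<not> P x) F"
    by (auto simp: ultrafilter_def)
qed

lemma ultrafilter_below:
  fixes F :: "'a filter"
  assumes "F \<noteq> bot"
  shows "\<exists>G\<le>F. ultrafilter G"
proof -
  define A where "A = {G. G \<noteq> bot \<and> G \<le> F}"
  have po: "partial_order_on A (relation_of (\<lambda>x y. y \<le> x) A)"
    by (rule partial_order_on_relation_ofI) auto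
  have "\<exists>m\<in>A. \<forall>a\<in>A. a \<le> m \<longrightarrow> a = m"
  proof (rule predicate_Zorn[OF po])
    fix C assume "C \<in> Chains (relation_of (\<lambda>x y. y \<le> x) A)"
    then have C: "C \<subseteq> A" "\<And>x y. x \<in> C \<Longrightarrow> y \<in> C \<Longrightarrow> x \<le> y \<or> y \<le> x"
      by (auto simp: Chains_def relation_of_def)
    show "\<exists>u\<in>A. \<forall>a\<in>C. u \<le> a"
    proof (cases "C = {}")
      case True
      then show ?thesis using assms by (auto simp: A_def)
    next
      case False
      have "eventually P (Inf C) \<longleftrightarrow> (\<exists>b\<in>C. eventually P b)" for P
      proof (rule eventually_Inf_base[OF False])
        fix X Y assume "X \<in> C" "Y \<in> C"
        then show "\<exists>x\<in>C. x \<le> inf X Y"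
          using C(2)[of X Y] by (auto simp: le_inf_iff)
      qed
      then have "Inf C \<noteq> bot"
        using C(1) by (auto simp: trivial_limit_def A_def)
      moreover have "Inf C \<le> F"
        using False C(1) by (auto simp: A_def intro: Inf_lower2)
      ultimately show ?thesis
        by (auto simp: A_def intro: Inf_lower)
    qed
  qed
  then obtain M where M: "M \<noteq> bot" "M \<le> F" "\<And>G. G \<noteq> bot \<Longrightarrow> G \<le> M \<Longrightarrow> G = M"
    by (auto simp: A_def)
  have "eventually P M \<or> eventually (\<lambda>x. \<not> P x) M" for P
  proof (rule disjCI)
    assume "\<not> eventually (\<lambda>x. \<not> P x) M"
    then have "inf M (principal {x. P x}) \<noteq> bot"
      by (auto simp: trivial_limit_def eventually_inf_principal)
    then have "inf M (principal {x. P x}) = M"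
      using M(3) by auto
    moreover have "eventually P (inf M (principal {x. P x}))"
      by (simp add: eventually_inf_principal)
    ultimately show "eventually P M" by simp
  qed
  with M show ?thesis by (auto simp: ultrafilter_def)
qed

lemma ultrafilter_principal: "ultrafilter (principal {x})"
  by (auto simp: ultrafilter_def eventually_principal principal_eq_bot_iff)

section \<open>The Cech-Stone compactification of the discrete space of natural numbers\<close>

text \<open>The points are the ultrafilters, with the topology generated by the sets of all
  ultrafilters containing a given \<open>A\<close>. The lemmas below establish that this space is compact
  and Hausdorff, and that \<open>\<omega>\<close> is a discrete, dense and C*-embedded subspace of it.\<close>

typedef beta_omega = "{F :: nat filter. ultrafilter F}"
  by (rule exI[of _ "principal {0}"]) (simp add: ultrafilter_principal)

instantiation beta_omega :: topological_space
begin

definition open_beta_omega :: "beta_omega set \<Rightarrow> bool" where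
  "open_beta_omega =
     generate_topology (range (\<lambda>A :: nat set. {p. eventually (\<lambda>n. n \<in> A) (Rep_beta_omega p)}))"

instance
  by standard (auto simp: open_beta_omega_def generate_topology.UNIV
      intro: generate_topology.Int generate_topology.UN)

end

definition omega_embedding :: "nat \<Rightarrow> beta_omega" where
  "omega_embedding n = Abs_beta_omega (principal {n})"

lemma Rep_omega_embedding: "Rep_beta_omega (omega_embedding n) = principal {n}"
  by (simp add: omega_embedding_def Abs_beta_omega_inverse ultrafilter_principal)

lemma ultrafilter_Rep: "ultrafilter (Rep_beta_omega p)"
  using Rep_beta_omega by auto

lemma Rep_beta_omega_not_bot: "Rep_beta_omega p \<noteq> bot"
  using ultrafilter_Rep[of p] by (simp add: ultrafilter_def)

lemma open_beta_omega_basic: "open {p. eventually P (Rep_beta_omega p)}"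
proof -
  have "{p. eventually P (Rep_beta_omega p)} =
      {p. eventually (\<lambda>n. n \<in> {n. P n}) (Rep_beta_omega p)}" by simp
  then show ?thesis
    unfolding open_beta_omega_def by (blast intro: generate_topology.Basis)
qed

lemma open_beta_omega_nbhd:
  assumes "open S" "p \<in> S"
  shows "\<exists>P. eventually P (Rep_beta_omega p) \<and> {q. eventually P (Rep_beta_omega q)} \<subseteq> S"
proof -
  have "generate_topology (range (\<lambda>A. {p. eventually (\<lambda>n. n \<in> A) (Rep_beta_omega p)})) S"
    using assms(1) by (simp add: open_beta_omega_def)
  then show ?thesis using assms(2)
  proof (induction S arbitrary: p)
    case UNIV
    then show ?case by (auto intro!: exI[of _ "\<lambda>_. True"])
  next
    case (Int a b)
    from Int.IH(1)[of p] Int.prems obtain P where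
      "eventually P (Rep_beta_omega p)" "{q. eventually P (Rep_beta_omega q)} \<subseteq> a" by auto
    moreover from Int.IH(2)[of p] Int.prems obtain Q where
      "eventually Q (Rep_beta_omega p)" "{q. eventually Q (Rep_beta_omega q)} \<subseteq> b" by auto
    ultimately show ?case
      by (intro exI[of _ "\<lambda>n. P n \<and> Q n"]) (auto simp: eventually_conj_iff)
  next
    case (UN K)
    then show ?case by blast
  next
    case (Basis s)
    then show ?case by blast
  qed
qed

instance beta_omega :: t2_space
proof
  fix p q :: beta_omega
  assume "p \<noteq> q"
  then have "Rep_beta_omega p \<noteq> Rep_beta_omega q" by (simp add: Rep_beta_omega_inject)
  then obtain P where P: "eventually P (Rep_beta_omega p) \<noteq> eventually P (Rep_beta_omega q)"
    by (auto simp: filter_eq_iff)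
  have *: "\<exists>U V. open U \<and> open V \<and> x \<in> U \<and> y \<in> V \<and> U \<inter> V = {}"
    if "eventually P (Rep_beta_omega x)" "\<not> eventually P (Rep_beta_omega y)" for x y
    using that
    by (intro exI[of _ "{p. eventually P (Rep_beta_omega p)}"]
          exI[of _ "{p. eventually (\<lambda>n. \<not> P n) (Rep_beta_omega p)}"] conjI open_beta_omega_basic)
       (auto simp: ultrafilter_not_eventually[OF ultrafilter_Rep])
  show "\<exists>U V. open U \<and> open V \<and> p \<in> U \<and> q \<in> V \<and> U \<inter> V = {}"
  proof (cases "eventually P (Rep_beta_omega p)")
    case True
    with P *[of p q] show ?thesis by simp
  next
    case False
    with P *[of q p] obtain U V where "open U" "open V" "q \<in> U" "p \<in> V" "U \<inter> V = {}" by auto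
    then show ?thesis by (intro exI[of _ V] exI[of _ U]) auto
  qed
qed

lemma compact_beta_omega: "compact (UNIV :: beta_omega set)"
  unfolding compact_filter
proof (intro allI impI)
  fix F :: "beta_omega filter"
  assume "F \<noteq> bot"
  then obtain G where G: "G \<le> F" "ultrafilter G" using ultrafilter_below by blast
  define U where "U = Abs_filter (\<lambda>P. eventually (\<lambda>q. eventually P (Rep_beta_omega q)) G)"
  have ev: "eventually P U \<longleftrightarrow> eventually (\<lambda>q. eventually P (Rep_beta_omega q)) G" for P
    unfolding U_def
  proof (rule eventually_Abs_filter, standard)
    fix P Q :: "nat \<Rightarrow> bool"
    assume "eventually (\<lambda>q. eventually P (Rep_beta_omega q)) G"
      "eventually (\<lambda>q. eventually Q (Rep_beta_omega q)) G"
    then show "eventually (\<lambda>q. eventually (\<lambda>x. P x \<and> Q x) (Rep_beta_omega q)) G"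
      by eventually_elim (rule eventually_conj)
  next
    fix P Q :: "nat \<Rightarrow> bool"
    assume PQ: "\<forall>x. P x \<longrightarrow> Q x"
    assume "eventually (\<lambda>q. eventually P (Rep_beta_omega q)) G"
    then show "eventually (\<lambda>q. eventually Q (Rep_beta_omega q)) G"
      by eventually_elim (use PQ in \<open>auto elim: eventually_mono\<close>)
  qed simp
  have U: "ultrafilter U"
    using G(2) ultrafilter_Rep
    by (auto simp: ultrafilter_def ev ultrafilter_not_eventually[OF ultrafilter_Rep]
        trivial_limit_def)
  define p where "p = Abs_beta_omega U"
  have p: "Rep_beta_omega p = U" using U by (simp add: p_def Abs_beta_omega_inverse)
  have "G \<le> nhds p"
    unfolding le_filter_def eventually_nhds
  proof safe
    fix P S assume S: "open S" "p \<in> S" "\<forall>x\<in>S. P x"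
    from open_beta_omega_nbhd[OF S(1,2)] obtain Q where
      Q: "eventually Q U" "{q. eventually Q (Rep_beta_omega q)} \<subseteq> S" by (auto simp: p)
    from Q(1)[unfolded ev] show "eventually P G"
      by eventually_elim (use Q(2) S(3) in auto)
  qed
  with G(1) have le: "G \<le> inf (nhds p) F" by simp
  have "inf (nhds p) F \<noteq> bot"
  proof
    assume "inf (nhds p) F = bot"
    with le have "G = bot" by (simp add: le_bot)
    with G(2) show False by (simp add: ultrafilter_def)
  qed
  then show "\<exists>x\<in>UNIV. inf (nhds x) F \<noteq> bot" by auto
qed

lemma inj_omega_embedding: "inj omega_embedding"
proof (rule injI)
  fix m n assume "omega_embedding m = omega_embedding n"
  then have "Rep_beta_omega (omega_embedding m) = Rep_beta_omega (omega_embedding n)"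
    by (rule arg_cong)
  then have "principal {m} = principal {n}"
    unfolding Rep_omega_embedding .
  then show "m = n" by simp
qed

lemma open_omega_embedding: "open {omega_embedding n}"
proof -
  have "p = omega_embedding n" if "eventually (\<lambda>k. k = n) (Rep_beta_omega p)" for p
  proof -
    have "Rep_beta_omega p = principal {n}"
    proof (rule antisym)
      show le: "Rep_beta_omega p \<le> principal {n}"
        using that by (simp add: le_principal)
      show "principal {n} \<le> Rep_beta_omega p"
        unfolding le_filter_def
      proof safe
        fix P assume "eventually P (Rep_beta_omega p)"
        with that have "eventually (\<lambda>k. P n) (Rep_beta_omega p)"
          by eventually_elim auto
        then show "eventually P (principal {n})"
          using ultrafilter_Rep[of p] by (auto simp: eventually_principal ultrafilter_def)
      qed
    qed
    then show ?thesis by (metis Rep_beta_omega_inject Rep_omega_embedding)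
  qed
  then have "{omega_embedding n} = {p. eventually (\<lambda>k. k = n) (Rep_beta_omega p)}"
    by (auto simp: Rep_omega_embedding eventually_principal)
  then show ?thesis using open_beta_omega_basic by simp
qed

lemma dense_omega_embedding: "closure (range omega_embedding) = UNIV"
proof -
  have *: "\<exists>n. omega_embedding n \<in> S" if "open S" "p \<in> S" for S p
  proof -
    from open_beta_omega_nbhd[OF that] obtain P where
      P: "eventually P (Rep_beta_omega p)" "{q. eventually P (Rep_beta_omega q)} \<subseteq> S" by blast
    have "\<exists>n. P n"
      using eventually_happens[OF P(1)] Rep_beta_omega_not_bot[of p] by simp
    then obtain n where "P n" ..
    then have "omega_embedding n \<in> {q. eventually P (Rep_beta_omega q)}"
      by (simp add: Rep_omega_embedding eventually_principal)
    with P(2) show ?thesis by blast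
  qed
  then have "p \<in> closure (range omega_embedding)" for p
  proof (unfold closure_iff_nhds_not_empty, intro allI impI)
    fix A U assume U: "U \<subseteq> A" "open U" "p \<in> U"
    with *[of U p] show "range omega_embedding \<inter> A \<noteq> {}" by blast
  qed
  then show ?thesis by blast
qed

lemma omega_C_star_embedded:
  fixes f :: "nat \<Rightarrow> real"
  assumes "bounded (range f)"
  shows "\<exists>g. continuous_on UNIV g \<and> (\<forall>n. g (omega_embedding n) = f n)"
proof -
  have "\<exists>l. (f \<longlongrightarrow> l) (Rep_beta_omega p)" for p
  proof -
    let ?F = "filtermap f (Rep_beta_omega p)"
    have "compact (closure (range f))" using assms by (simp add: compact_closure)
    moreover have "?F \<noteq> bot" using Rep_beta_omega_not_bot by (simp add: filtermap_bot_iff)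
    moreover have "eventually (\<lambda>x. x \<in> closure (range f)) ?F"
      using closure_subset[of "range f"] by (auto simp: eventually_filtermap intro!: always_eventually)
    ultimately obtain l where l: "inf (nhds l) ?F \<noteq> bot"
      by (auto simp: compact_filter)
    have "eventually (\<lambda>n. f n \<in> S) (Rep_beta_omega p)" if S: "open S" "l \<in> S" for S
    proof (rule ccontr)
      assume "\<not> eventually (\<lambda>n. f n \<in> S) (Rep_beta_omega p)"
      then have "eventually (\<lambda>n. \<not> f n \<in> S) (Rep_beta_omega p)"
        by (simp add: ultrafilter_not_eventually[OF ultrafilter_Rep])
      then have "eventually (\<lambda>x. x \<notin> S) ?F" by (simp add: eventually_filtermap)
      moreover have "eventually (\<lambda>x. x \<in> S) (nhds l)"
        using S by (rule eventually_nhds_in_open)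
      ultimately have "eventually (\<lambda>_. False) (inf (nhds l) ?F)"
        unfolding eventually_inf by blast
      with l show False by (simp add: trivial_limit_def)
    qed
    then show ?thesis by (auto simp: tendsto_def)
  qed
  then obtain g where g: "\<And>p. (f \<longlongrightarrow> g p) (Rep_beta_omega p)" by metis
  have "g (omega_embedding n) = f n" for n
  proof (rule tendsto_unique)
    show "principal {n} \<noteq> bot" by (simp add: principal_eq_bot_iff)
    show "(f \<longlongrightarrow> g (omega_embedding n)) (principal {n})"
      using g[of "omega_embedding n"] by (simp add: Rep_omega_embedding)
    show "(f \<longlongrightarrow> f n) (principal {n})"
      by (auto simp: tendsto_def eventually_principal)
  qed
  moreover have "isCont g p" for p
    unfolding continuous_at tendsto_iff
  proof safe
    fix e :: real assume e: "e > 0"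
    let ?P = "\<lambda>n. dist (f n) (g p) < e / 2"
    have P: "eventually ?P (Rep_beta_omega p)" using tendstoD[OF g[of p], of "e / 2"] e by simp
    have "dist (g q) (g p) < e" if "eventually ?P (Rep_beta_omega q)" for q
    proof -
      have "dist (g q) (g p) \<le> e / 2"
      proof (rule tendsto_upperbound)
        show "((\<lambda>n. dist (f n) (g p)) \<longlongrightarrow> dist (g q) (g p)) (Rep_beta_omega q)"
          by (intro tendsto_dist g tendsto_const)
        show "eventually (\<lambda>n. dist (f n) (g p) \<le> e / 2) (Rep_beta_omega q)"
          using that by eventually_elim simp
        show "Rep_beta_omega q \<noteq> bot" by (rule Rep_beta_omega_not_bot)
      qed
      with e show ?thesis by simp
    qed
    then have "eventually (\<lambda>q. dist (g q) (g p) < e) (nhds p)"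
      using P open_beta_omega_basic[of ?P]
      by (auto simp: eventually_nhds intro!: exI[of _ "{q. eventually ?P (Rep_beta_omega q)}"])
    then show "eventually (\<lambda>q. dist (g q) (g p) < e) (at p)"
      unfolding eventually_at_filter by (rule eventually_mono) simp
  qed
  ultimately show ?thesis by (auto simp: continuous_on_eq_continuous_at)
qed

section \<open>The remainder \<open>\<omega>\<^sup>* = \<beta>\<omega> - \<omega>\<close>\<close>

lemma remainder_nonempty: "- range omega_embedding \<noteq> {}"
proof
  assume "- range omega_embedding = {}"
  then have r: "range omega_embedding = UNIV" by auto
  have "UNIV \<subseteq> \<Union>(range (\<lambda>n. {omega_embedding n}))" using r by auto
  then obtain D where D: "D \<subseteq> range (\<lambda>n. {omega_embedding n})" "finite D" "UNIV \<subseteq> \<Union>D"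
    by (rule compactE[OF compact_beta_omega]) (use open_omega_embedding in auto)
  have "finite (\<Union>D)" using D(1,2) by (auto intro!: finite_Union)
  then have "finite (UNIV :: beta_omega set)" using D(3) finite_subset by blast
  then have "finite (range omega_embedding)" by (rule finite_subset[rotated]) simp
  then show False using inj_omega_embedding finite_imageD by blast
qed

typedef omega_star = "- range omega_embedding"
  using remainder_nonempty by blast

instantiation omega_star :: topological_space
begin

definition open_omega_star :: "omega_star set \<Rightarrow> bool" where
  "open_omega_star S \<longleftrightarrow> (\<exists>T. open T \<and> S = Rep_omega_star -` T)"

instance
proof
  show "open (UNIV :: omega_star set)"
    unfolding open_omega_star_def by (rule exI[of _ UNIV]) simp
next
  fix S T :: "omega_star set"
  assume "open S" "open T"
  then obtain S' T' where
    "open S'" "S = Rep_omega_star -` S'" "open T'" "T = Rep_omega_star -` T'"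
    unfolding open_omega_star_def by blast
  then show "open (S \<inter> T)"
    unfolding open_omega_star_def by (intro exI[of _ "S' \<inter> T'"]) auto
next
  fix K :: "omega_star set set"
  assume "\<forall>S\<in>K. open S"
  then have K: "\<exists>T. open T \<and> S = Rep_omega_star -` T" if "S \<in> K" for S
    using that unfolding open_omega_star_def by simp
  let ?T = "\<Union>{T. open T \<and> Rep_omega_star -` T \<in> K}"
  have "\<Union>K = Rep_omega_star -` ?T"
  proof (intro equalityI subsetI)
    fix x assume "x \<in> \<Union>K"
    then obtain S where S: "S \<in> K" "x \<in> S" by blast
    from K[OF S(1)] obtain T where "open T" "S = Rep_omega_star -` T" by blast
    with S show "x \<in> Rep_omega_star -` ?T" by auto
  qed auto
  moreover have "open ?T" by (rule open_Union) simp
  ultimately show "open (\<Union>K)"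
    unfolding open_omega_star_def by (intro exI[of _ ?T] conjI)
qed

end

lemma compact_omega_star: "compact (UNIV :: omega_star set)"
proof -
  have cl: "closed (- range omega_embedding)"
  proof -
    have "open (\<Union>n. {omega_embedding n})" by (intro open_UN ballI open_omega_embedding)
    moreover have "(\<Union>n. {omega_embedding n}) = range omega_embedding" by auto
    ultimately show ?thesis by (simp add: closed_def)
  qed
  have "compact (- range omega_embedding)"
    using compact_Int_closed[OF compact_beta_omega cl] by simp
  then have "compact (range Rep_omega_star)"
    using type_definition.Rep_range[OF type_definition_omega_star] by simp
  moreover have "continuous_on (range Rep_omega_star) Abs_omega_star"
    unfolding continuous_on_open_invariant
  proof (intro allI impI)
    fix B :: "omega_star set"
    assume "open B"
    then obtain T where "open T" "B = Rep_omega_star -` T"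
      unfolding open_omega_star_def by blast
    then show "\<exists>A. open A \<and> A \<inter> range Rep_omega_star = Abs_omega_star -` B \<inter> range Rep_omega_star"
      by (intro exI[of _ T]) (auto simp: Rep_omega_star_inverse)
  qed
  ultimately have "compact (Abs_omega_star ` range Rep_omega_star)"
    by (rule compact_continuous_image[rotated])
  moreover have "Abs_omega_star ` range Rep_omega_star = UNIV"
    by (auto simp: image_image Rep_omega_star_inverse)
  ultimately show ?thesis by simp
qed

section \<open>Topologies on spaces of continuous functions and their Borel sets\<close>

text \<open>On a compact space every continuous function is bounded, so \<open>C(K)\<close> with the
  supremum norm is the library space \<open>K \<Rightarrow>\<^sub>C real\<close>.\<close>

definition pointwise_topology ::
    "('a::topological_space \<Rightarrow>\<^sub>C 'b::metric_space) topology" where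
  "pointwise_topology =
     topology_generated_by {{f. apply_bcontfun f x \<in> U} | x U. open U}"

definition weak_topology :: "'a::real_normed_vector topology" where
  "weak_topology =
     topology_generated_by {\<phi> -` U | (\<phi> :: 'a \<Rightarrow> real) U. bounded_linear \<phi> \<and> open U}"

definition borel_sets :: "'a topology \<Rightarrow> 'a set set" where
  "borel_sets X = sigma_sets (topspace X) {U. openin X U}"

end

(* Averaging (Cesaro means along a free ultrafilter) the lifts of continuous functions on omega*
   to sequences gives a bounded functional that extends asymptotic density. The weakly open set
   of all f with value > 1/2 is not pointwise Borel. To see this, consider partial 0-1 functions
   on subsets of omega of density at most 1/4, and the 0-1 functions on omega* induced by their
   extensions, taken modulo finite sets. For every pointwise Borel set there is such a partial
   function all of whose extensions, or none of whose extensions, lie in the set: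
   - for open sets, because finitely many ultrafilters have a common element of small density;
   - for countable unions, because an increasing sequence of sets of density at most a is almost
     contained in a single set of density at most a.
   But each of these partial functions has extensions with value at most 1/4 and at least 3/4. *)
theory Submission
  imports Defs
begin

section \<open>Points of the remainder as free ultrafilters\<close>

abbreviation free_ultrafilter :: "omega_star \<Rightarrow> nat filter" where
  "free_ultrafilter x \<equiv> Rep_beta_omega (Rep_omega_star x)"

text \<open>An ultrafilter containing a singleton is principal, hence a point of omega. So a point
  of the remainder contains every cofinite set.\<close>

lemma eventually_free_ultrafilterI:
  assumes "eventually P sequentially"
  shows "eventually P (free_ultrafilter x)"
proof -
  have "eventually (\<lambda>k. k \<noteq> n) (free_ultrafilter x)" for n
  proof (rule ccontr)
    assume "\<not> ?thesis"
    then have ev: "eventually (\<lambda>k. k = n) (free_ultrafilter x)"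
      using ultrafilter_Rep by (auto simp: ultrafilter_def)
    have "free_ultrafilter x = principal {n}"
    proof (rule antisym)
      show "free_ultrafilter x \<le> principal {n}"
        using ev by (simp add: le_principal)
      show "principal {n} \<le> free_ultrafilter x"
        unfolding le_filter_def
      proof safe
        fix Q assume "eventually Q (free_ultrafilter x)"
        with ev have "eventually (\<lambda>k. Q n) (free_ultrafilter x)"
          by eventually_elim auto
        then show "eventually Q (principal {n})"
          using Rep_beta_omega_not_bot by (auto simp: eventually_principal)
      qed
    qed
    then have "Rep_omega_star x = omega_embedding n"
      by (metis Rep_beta_omega_inject Rep_omega_embedding)
    then show False using Rep_omega_star[of x] by auto
  qed
  then have *: "eventually (\<lambda>k. \<forall>n\<in>{..<N}. k \<noteq> n) (free_ultrafilter x)" for N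
    by (simp add: eventually_ball_finite)
  obtain N where N: "\<And>n. n \<ge> N \<Longrightarrow> P n"
    using assms by (auto simp: eventually_sequentially)
  show ?thesis using *[of N] by eventually_elim (metis N lessThan_iff not_less)
qed

lemma free_ultrafilter_surj:
  assumes "ultrafilter U" "U \<le> sequentially"
  obtains x where "free_ultrafilter x = U"
proof -
  have R: "Rep_beta_omega (Abs_beta_omega U) = U"
    using assms(1) by (simp add: Abs_beta_omega_inverse)
  have "Abs_beta_omega U \<noteq> omega_embedding n" for n
  proof
    assume "Abs_beta_omega U = omega_embedding n"
    then have "U = principal {n}" using R Rep_omega_embedding by metis
    with assms(2) have "eventually (\<lambda>k. k > n) (principal {n})"
      by (auto simp: le_filter_def eventually_gt_at_top)
    then show False by (simp add: eventually_principal)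
  qed
  then have "Abs_beta_omega U \<in> - range omega_embedding" by auto
  then show thesis using R by (intro that[of "Abs_omega_star (Abs_beta_omega U)"])
      (simp add: Abs_omega_star_inverse)
qed

text \<open>If \<open>P\<close> failed infinitely often, the cofinite filter restricted to the
  failures would be proper, and an ultrafilter below it would be a free one containing the
  failures.\<close>

lemma eventually_sequentially_if_free_ultrafilters:
  assumes "\<And>x. eventually P (free_ultrafilter x)"
  shows "eventually P sequentially"
proof (rule ccontr)
  assume "\<not> ?thesis"
  then have "inf sequentially (principal {n. \<not> P n}) \<noteq> bot"
    by (auto simp: trivial_limit_def eventually_inf_principal)
  then obtain U where U: "U \<le> inf sequentially (principal {n. \<not> P n})" "ultrafilter U"
    using ultrafilter_below by blast
  then obtain x where x: "free_ultrafilter x = U"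
    by (auto intro: free_ultrafilter_surj)
  have "eventually (\<lambda>n. \<not> P n) U"
    using U(1) by (auto simp: le_principal)
  moreover have "eventually P U" using assms[of x] x by simp
  ultimately show False
    using ultrafilter_not_eventually[OF U(2)] by blast
qed

text \<open>Compactness supplies a cluster point, and an ultrafilter converges to each of its
  cluster points.\<close>

lemma ultrafilter_bounded_tendsto:
  fixes f :: "'a \<Rightarrow> 'b::heine_borel"
  assumes "ultrafilter U" "bounded (range f)"
  shows "\<exists>l. (f \<longlongrightarrow> l) U"
proof -
  let ?F = "filtermap f U"
  have "compact (closure (range f))" using assms by (simp add: compact_closure)
  moreover have "?F \<noteq> bot" using assms(1) by (simp add: filtermap_bot_iff ultrafilter_def)
  moreover have "eventually (\<lambda>x. x \<in> closure (range f)) ?F"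
    using closure_subset[of "range f"] by (auto simp: eventually_filtermap intro!: always_eventually)
  ultimately obtain l where l: "inf (nhds l) ?F \<noteq> bot"
    by (auto simp: compact_filter)
  have "eventually (\<lambda>n. f n \<in> S) U" if S: "open S" "l \<in> S" for S
  proof (rule ccontr)
    assume "\<not> eventually (\<lambda>n. f n \<in> S) U"
    then have "eventually (\<lambda>x. x \<notin> S) ?F"
      by (simp add: ultrafilter_not_eventually[OF assms(1)] eventually_filtermap)
    moreover have "eventually (\<lambda>x. x \<in> S) (nhds l)"
      using S by (rule eventually_nhds_in_open)
    ultimately have "eventually (\<lambda>_. False) (inf (nhds l) ?F)"
      unfolding eventually_inf by blast
    with l show False by (simp add: trivial_limit_def)
  qed
  then show ?thesis by (auto simp: tendsto_def)
qed

section \<open>Lifting functions from the remainder to sequences\<close>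

definition lifts_to :: "(omega_star \<Rightarrow>\<^sub>C real) \<Rightarrow> (nat \<Rightarrow> real) \<Rightarrow> bool" where
  "lifts_to f F \<longleftrightarrow> bounded (range F) \<and> (\<forall>x. (F \<longlongrightarrow> apply_bcontfun f x) (free_ultrafilter x))"

lemma lifts_to_add: "lifts_to f F \<Longrightarrow> lifts_to g G \<Longrightarrow> lifts_to (f + g) (\<lambda>n. F n + G n)"
  by (auto simp: lifts_to_def intro!: tendsto_add bounded_plus_comp)

lemma lifts_to_scaleR: "lifts_to f F \<Longrightarrow> lifts_to (c *\<^sub>R f) (\<lambda>n. c * F n)"
  using bounded_scaling[of "range F" c]
  by (auto simp: lifts_to_def image_image intro!: tendsto_mult_left)

text \<open>The difference tends to 0 along each free ultrafilter, and a property holding along all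
  of them holds cofinitely.\<close>

lemma lifts_to_unique:
  assumes "lifts_to f F" "lifts_to f G"
  shows "(\<lambda>n. F n - G n) \<longlonglongrightarrow> 0"
  unfolding tendsto_iff
proof safe
  fix e :: real assume "e > 0"
  moreover have "((\<lambda>n. F n - G n) \<longlongrightarrow> 0) (free_ultrafilter x)" for x
    using assms tendsto_diff[of F "f x" _ G "f x"] by (auto simp: lifts_to_def)
  ultimately show "eventually (\<lambda>n. dist (F n - G n) 0 < e) sequentially"
    by (intro eventually_sequentially_if_free_ultrafilters tendstoD)
qed

section \<open>Extending continuous functions from the remainder over beta omega\<close>

lemma normal_space_beta_omega: "normal_space (euclidean :: beta_omega topology)"
proof (rule compact_Hausdorff_or_regular_imp_normal_space)
  show "compact_space (euclidean :: beta_omega topology)"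
    using compact_beta_omega by (simp add: compact_space_def)
  have "Hausdorff_space (euclidean :: beta_omega topology)"
    unfolding Hausdorff_space_def disjnt_def using hausdorff by (metis open_openin)
  then show "Hausdorff_space (euclidean :: beta_omega topology) \<or>
      regular_space (euclidean :: beta_omega topology)" ..
qed

lemma closed_remainder: "closed (- range omega_embedding)"
proof -
  have "open (\<Union>n. {omega_embedding n})" by (intro open_UN ballI open_omega_embedding)
  moreover have "(\<Union>n. {omega_embedding n}) = range omega_embedding" by auto
  ultimately show ?thesis by (simp add: closed_def)
qed

lemma continuous_on_Abs_omega_star: "continuous_on (- range omega_embedding) Abs_omega_star"
  unfolding continuous_on_open_invariant
proof (intro allI impI)
  fix B :: "omega_star set"
  assume "open B"
  then obtain T where "open T" "B = Rep_omega_star -` T"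
    unfolding open_omega_star_def by blast
  then show "\<exists>A. open A \<and> A \<inter> - range omega_embedding =
      Abs_omega_star -` B \<inter> - range omega_embedding"
    by (intro exI[of _ T]) (auto simp: Abs_omega_star_inverse)
qed

text \<open>A basic neighbourhood of \<open>p\<close> is given by a set belonging to the ultrafilter
  \<open>p\<close>, and it contains the image of that set under the embedding.\<close>

lemma beta_omega_tendsto:
  assumes "continuous_on UNIV g"
  shows "((\<lambda>n. g (omega_embedding n)) \<longlongrightarrow> g p) (Rep_beta_omega p)"
  unfolding tendsto_def
proof safe
  fix S assume S: "open S" "g p \<in> S"
  then have "open (g -` S)" using assms by (simp add: continuous_on_open_vimage)
  then obtain P where P: "eventually P (Rep_beta_omega p)"
      "{q. eventually P (Rep_beta_omega q)} \<subseteq> g -` S"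
    using open_beta_omega_nbhd[of "g -` S" p] S by auto
  from P(1) show "eventually (\<lambda>n. g (omega_embedding n) \<in> S) (Rep_beta_omega p)"
  proof eventually_elim
    case (elim n)
    then have "omega_embedding n \<in> {q. eventually P (Rep_beta_omega q)}"
      by (simp add: Rep_omega_embedding eventually_principal)
    with P(2) show ?case by blast
  qed
qed

text \<open>Tietze's theorem extends \<open>f\<close> from the closed remainder to the normal space
  beta omega without leaving the interval of radius \<open>norm f\<close>; the lift is the
  restriction to omega. The bound later gives the density functional norm at most 1.\<close>

lemma lifts_to_exists:
  obtains F where "lifts_to f F" "\<And>n. \<bar>F n\<bar> \<le> norm f"
proof -
  let ?R = "- range omega_embedding"
  have "continuous_map (subtopology euclidean ?R) euclideanreal (\<lambda>p. f (Abs_omega_star p))"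
    by (simp, rule continuous_on_compose2[OF _ continuous_on_Abs_omega_star]) auto
  moreover have "(\<lambda>p. f (Abs_omega_star p)) ` ?R \<subseteq> {- norm f..norm f}"
    using norm_bounded[of f] by (auto simp: abs_le_iff) (metis minus_le_iff)
  ultimately obtain g where g: "continuous_on UNIV g" "\<And>p. p \<in> ?R \<Longrightarrow> g p = f (Abs_omega_star p)"
      "range g \<subseteq> {- norm f..norm f}"
    using Tietze_extension_closed_real_interval[OF normal_space_beta_omega, of ?R]
      closed_remainder by (force simp: closed_closedin[symmetric])
  have b: "\<bar>g p\<bar> \<le> norm f" for p using g(3) by (auto simp: abs_le_iff image_subset_iff) (metis minus_le_iff)
  show thesis
  proof
    have "g (Rep_omega_star x) = f x" for x
      using g(2)[of "Rep_omega_star x"] Rep_omega_star[of x] by (simp add: Rep_omega_star_inverse)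
    then have "((\<lambda>n. g (omega_embedding n)) \<longlongrightarrow> f x) (free_ultrafilter x)" for x
      using beta_omega_tendsto[OF g(1), of "Rep_omega_star x"] by simp
    then show "lifts_to f (\<lambda>n. g (omega_embedding n))"
      using b by (auto simp: lifts_to_def bounded_iff)
  qed (rule b)
qed

section \<open>Clopen indicators\<close>

lemma indicator_free_ultrafilter_bcontfun:
  "(\<lambda>x. if eventually (\<lambda>n. n \<in> C) (free_ultrafilter x) then 1 else 0 :: real) \<in> bcontfun"
proof -
  have o: "open {x. eventually P (free_ultrafilter x)}" for P
    unfolding open_omega_star_def
    by (rule exI[of _ "{p. eventually P (Rep_beta_omega p)}"]) (auto simp: open_beta_omega_basic)
  let ?V = "{x. eventually (\<lambda>n. n \<in> C) (free_ultrafilter x)}"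
  have "- ?V = {x. eventually (\<lambda>n. n \<notin> C) (free_ultrafilter x)}"
    by (auto simp: ultrafilter_not_eventually[OF ultrafilter_Rep])
  then have "open (- ?V)" using o[of "\<lambda>n. n \<notin> C"] by simp
  moreover have "open ?V" by (rule o)
  ultimately have "continuous_on (?V \<union> - ?V) (\<lambda>x. if x \<in> ?V then 1 else 0 :: real)"
    by (intro continuous_on_cases) (auto simp: closed_def)
  then show ?thesis by (auto simp: bcontfun_def bounded_iff intro!: exI[of _ 1])
qed

definition clopen_ind :: "nat set \<Rightarrow> omega_star \<Rightarrow>\<^sub>C real" where
  "clopen_ind C = Bcontfun (\<lambda>x. if eventually (\<lambda>n. n \<in> C) (free_ultrafilter x) then 1 else 0)"

lemma apply_clopen_ind:
  "clopen_ind C x = (if eventually (\<lambda>n. n \<in> C) (free_ultrafilter x) then 1 else 0)"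
  unfolding clopen_ind_def by (simp add: Bcontfun_inverse[OF indicator_free_ultrafilter_bcontfun])

lemma lifts_to_clopen_ind: "lifts_to (clopen_ind C) (indicator C)"
  unfolding lifts_to_def
proof (intro conjI allI)
  show "bounded (range (indicator C :: nat \<Rightarrow> real))"
    by (auto simp: bounded_iff indicator_def intro!: exI[of _ 1])
  fix x
  have "eventually (\<lambda>n. indicator C n = clopen_ind C x) (free_ultrafilter x)"
  proof (cases "eventually (\<lambda>n. n \<in> C) (free_ultrafilter x)")
    case True
    then show ?thesis unfolding apply_clopen_ind by eventually_elim (simp add: True)
  next
    case False
    then have "eventually (\<lambda>n. n \<notin> C) (free_ultrafilter x)"
      by (simp add: ultrafilter_not_eventually[OF ultrafilter_Rep])
    then show ?thesis unfolding apply_clopen_ind by eventually_elim (simp add: False)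
  qed
  then show "(indicator C \<longlongrightarrow> clopen_ind C x) (free_ultrafilter x)"
    by (rule tendsto_eventually)
qed

section \<open>Densities of sets and the density functional\<close>

definition cesaro :: "(nat \<Rightarrow> real) \<Rightarrow> nat \<Rightarrow> real" where
  "cesaro F n = (\<Sum>i<n. F i) / real n"

lemma abs_cesaro_le:
  assumes "\<And>i. \<bar>F i\<bar> \<le> c"
  shows "\<bar>cesaro F n\<bar> \<le> c"
proof -
  \<comment> \<open>At \<open>n = 0\<close> the mean is 0 by the convention for division by zero, so
    there the bound amounts to this.\<close>
  have "0 \<le> c" using assms[of 0] by linarith
  have "\<bar>\<Sum>i<n. F i\<bar> \<le> (\<Sum>i<n. c)"
    using assms by (intro order_trans[OF sum_abs] sum_mono)
  then show ?thesis using \<open>0 \<le> c\<close>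
    by (cases "n = 0") (simp_all add: cesaro_def divide_simps mult.commute)
qed

lemma cesaro_null:
  assumes "F \<longlonglongrightarrow> 0"
  shows "cesaro F \<longlonglongrightarrow> 0"
proof (rule LIMSEQ_I)
  fix e :: real assume e: "e > 0"
  obtain N where N: "\<And>i. i \<ge> N \<Longrightarrow> \<bar>F i\<bar> < e / 2"
    using LIMSEQ_D[OF assms, of "e / 2"] e by auto
  define M where "M = (\<Sum>i<N. \<bar>F i\<bar>)"
  \<comment> \<open>Beyond \<open>N'\<close> the fixed head sum \<open>M\<close> is less than half
    of \<open>n * e\<close>; the tail terms contribute the other half. Taking \<open>n\<close> at
    least \<open>Suc N\<close> makes \<open>n\<close> positive for the division.\<close>
  obtain N' :: nat where N': "real N' > 2 * M / e" using reals_Archimedean2 by blast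
  have "norm (cesaro F n - 0) < e" if n: "n \<ge> max (Suc N) N'" for n
  proof -
    have "\<bar>\<Sum>i<n. F i\<bar> \<le> (\<Sum>i<n. \<bar>F i\<bar>)" by (rule sum_abs)
    also have "\<dots> = M + (\<Sum>i\<in>{N..<n}. \<bar>F i\<bar>)"
      using n unfolding M_def lessThan_atLeast0 by (subst sum.atLeastLessThan_concat) auto
    also have "(\<Sum>i\<in>{N..<n}. \<bar>F i\<bar>) \<le> (\<Sum>i\<in>{N..<n}. e / 2)"
      using N by (intro sum_mono) (auto intro: less_imp_le)
    also have "\<dots> \<le> real n * (e / 2)" using e by simp
    also have "M < real n * (e / 2)"
    proof -
      have "2 * M / e < real n" using N' n by simp
      then show ?thesis using e by (simp add: field_simps)
    qed
    finally have "\<bar>\<Sum>i<n. F i\<bar> < real n * e" by (simp add: mult.commute)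
    then show ?thesis using n by (simp add: cesaro_def pos_divide_less_eq) (simp add: mult.commute)
  qed
  then show "\<exists>n0. \<forall>n\<ge>n0. norm (cesaro F n - 0) < e" by blast
qed

lemma cesaro_add: "cesaro (\<lambda>n. F n + G n) n = cesaro F n + cesaro G n"
  by (simp add: cesaro_def sum.distrib add_divide_distrib)

lemma cesaro_diff: "cesaro (\<lambda>n. F n - G n) n = cesaro F n - cesaro G n"
  by (simp add: cesaro_def sum_subtractf diff_divide_distrib)

lemma cesaro_mult: "cesaro (\<lambda>n. c * F n) n = c * cesaro F n"
  by (simp add: cesaro_def sum_distrib_left)

lemma cesaro_indicator: "cesaro (indicator A) n = real (card (A \<inter> {..<n})) / real n"
  using Indicator_Function.sum_mult_indicator[of "{..<n}" "\<lambda>_. 1 :: real" A] by (simp add: cesaro_def Int_commute)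

section \<open>The limit of Cesaro means along a free ultrafilter, as a functional\<close>

definition density_functional :: "nat filter \<Rightarrow> (omega_star \<Rightarrow>\<^sub>C real) \<Rightarrow> real" where
  "density_functional U f = (THE l. \<exists>F. lifts_to f F \<and> (cesaro F \<longlongrightarrow> l) U)"

text \<open>The limit exists because the means are bounded. It does not depend on the lift: two
  lifts differ by a null sequence, whose means are null, and \<open>U\<close> refines the cofinite
  filter.\<close>

lemma tendsto_density_functional:
  assumes U: "ultrafilter U" "U \<le> sequentially" and F: "lifts_to f F"
  shows "(cesaro F \<longlongrightarrow> density_functional U f) U"
proof -
  have U_nontrivial: "U \<noteq> bot" using U(1) by (simp add: ultrafilter_def)
  obtain c where "\<And>n. \<bar>F n\<bar> \<le> c" using F by (auto simp: lifts_to_def bounded_iff)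
  then have "bounded (range (cesaro F))"
    using abs_cesaro_le unfolding bounded_iff by (metis rangeE real_norm_def)
  then obtain l where l: "(cesaro F \<longlongrightarrow> l) U"
    using ultrafilter_bounded_tendsto[OF U(1)] by blast
  have "density_functional U f = l"
    unfolding density_functional_def
  proof (rule the_equality)
    fix m assume "\<exists>G. lifts_to f G \<and> (cesaro G \<longlongrightarrow> m) U"
    then obtain G where G: "lifts_to f G" "(cesaro G \<longlongrightarrow> m) U" by blast
    have "cesaro (\<lambda>n. F n - G n) \<longlonglongrightarrow> 0"
      by (rule cesaro_null[OF lifts_to_unique[OF F G(1)]])
    then have "((\<lambda>n. cesaro F n - cesaro G n) \<longlongrightarrow> 0) U"
      unfolding cesaro_diff by (rule tendsto_mono[OF U(2)])
    moreover have "((\<lambda>n. cesaro F n - cesaro G n) \<longlongrightarrow> l - m) U"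
      by (intro tendsto_diff l G(2))
    ultimately have "l - m = 0" using tendsto_unique[OF U_nontrivial] by blast
    then show "m = l" by simp
  qed (use F l in blast)
  with l show ?thesis by simp
qed

lemma bounded_linear_density_functional:
  assumes U: "ultrafilter U" "U \<le> sequentially"
  shows "bounded_linear (density_functional U)"
proof (rule bounded_linear_intro[where K = 1])
  have U_nontrivial: "U \<noteq> bot" using U(1) by (simp add: ultrafilter_def)
  note lim = tendsto_density_functional[OF U]
  \<comment> \<open>Only the norm estimate needs a lift bounded by \<open>norm f\<close>; for
    \<open>g\<close> any lift will do.\<close>
  fix f g c
  obtain F where F: "lifts_to f F" "\<And>n. \<bar>F n\<bar> \<le> norm f" using lifts_to_exists by blast
  obtain G where G: "lifts_to g G" using lifts_to_exists by blast
  show "density_functional U (f + g) = density_functional U f + density_functional U g"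
    using lim[OF lifts_to_add[OF F(1) G]] tendsto_add[OF lim[OF F(1)] lim[OF G]]
    unfolding cesaro_add by (rule tendsto_unique[OF U_nontrivial])
  show "density_functional U (c *\<^sub>R f) = c *\<^sub>R density_functional U f"
    using lim[OF lifts_to_scaleR[OF F(1)], of c] tendsto_mult_left[OF lim[OF F(1)], of c]
    unfolding cesaro_mult real_scaleR_def by (rule tendsto_unique[OF U_nontrivial])
  have "((\<lambda>n. \<bar>cesaro F n\<bar>) \<longlongrightarrow> \<bar>density_functional U f\<bar>) U"
    by (intro tendsto_rabs lim F(1))
  then have "\<bar>density_functional U f\<bar> \<le> norm f"
    by (rule tendsto_upperbound) (use abs_cesaro_le[OF F(2)] U_nontrivial in auto)
  then show "norm (density_functional U f) \<le> norm f * 1" by simp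
qed

text \<open>This implies upper density at most \<open>a\<close>. Having no epsilon in it, the bounds
  simply add up under unions.\<close>

definition density_le :: "nat set \<Rightarrow> real \<Rightarrow> bool" where
  "density_le A a \<longleftrightarrow> (\<forall>\<^sub>F n in sequentially. real (card (A \<inter> {..<n})) \<le> a * real n)"

lemma density_functional_le:
  assumes U: "ultrafilter U" "U \<le> sequentially" and A: "density_le A a"
  shows "density_functional U (clopen_ind A) \<le> a"
proof (rule tendsto_upperbound)
  show "(cesaro (indicator A) \<longlongrightarrow> density_functional U (clopen_ind A)) U"
    by (rule tendsto_density_functional[OF U lifts_to_clopen_ind])
  have "eventually (\<lambda>n. cesaro (indicator A) n \<le> a) sequentially"
    using A[unfolded density_le_def] eventually_gt_at_top[of 0]
    by eventually_elim (simp add: cesaro_indicator divide_simps)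
  with U(2) show "eventually (\<lambda>n. cesaro (indicator A) n \<le> a) U"
    by (auto simp: le_filter_def)
  show "U \<noteq> bot" using U(1) by (simp add: ultrafilter_def)
qed

lemma density_functional_ge:
  assumes U: "ultrafilter U" "U \<le> sequentially" and A: "density_le (- A) a"
  shows "density_functional U (clopen_ind A) \<ge> 1 - a"
proof (rule tendsto_lowerbound)
  show "(cesaro (indicator A) \<longlongrightarrow> density_functional U (clopen_ind A)) U"
    by (rule tendsto_density_functional[OF U lifts_to_clopen_ind])
  have "eventually (\<lambda>n. 1 - a \<le> cesaro (indicator A) n) sequentially"
    using A[unfolded density_le_def] eventually_gt_at_top[of 0]
  proof eventually_elim
    case (elim n)
    have "n = card (A \<inter> {..<n} \<union> - A \<inter> {..<n})"
      by (simp add: Int_Un_distrib2[symmetric])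
    also have "\<dots> = card (A \<inter> {..<n}) + card (- A \<inter> {..<n})"
      by (rule card_Un_disjoint) auto
    finally have "real n = real (card (A \<inter> {..<n})) + real (card (- A \<inter> {..<n}))"
      by (metis of_nat_add)
    with elim show ?case by (simp add: cesaro_indicator field_simps)
  qed
  with U(2) show "eventually (\<lambda>n. 1 - a \<le> cesaro (indicator A) n) U"
    by (auto simp: le_filter_def)
  show "U \<noteq> bot" using U(1) by (simp add: ultrafilter_def)
qed

section \<open>Density bounds for unions, subsets and residue classes\<close>

lemma density_le_Un:
  assumes "density_le A a" "density_le B b"
  shows "density_le (A \<union> B) (a + b)"
  using assms unfolding density_le_def
proof eventually_elim
  case (elim n)
  have "card ((A \<union> B) \<inter> {..<n}) \<le> card (A \<inter> {..<n}) + card (B \<inter> {..<n})"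
    by (metis Int_Un_distrib2 card_Un_le)
  then have "real (card ((A \<union> B) \<inter> {..<n})) \<le> real (card (A \<inter> {..<n})) + real (card (B \<inter> {..<n}))"
    by linarith
  with elim show ?case by (simp add: algebra_simps)
qed

lemma density_le_mono: "density_le A a \<Longrightarrow> a \<le> b \<Longrightarrow> density_le A b"
  unfolding density_le_def
  by (erule eventually_mono) (meson mult_right_mono of_nat_0_le_iff order_trans)

lemma density_le_subset:
  assumes "density_le A a" "B \<subseteq> A"
  shows "density_le B a"
  using assms(1) unfolding density_le_def
proof eventually_elim
  case (elim n)
  have "card (B \<inter> {..<n}) \<le> card (A \<inter> {..<n})" using assms(2) by (intro card_mono) auto
  with elim show ?case by linarith
qed

lemma density_le_empty: "0 \<le> a \<Longrightarrow> density_le {} a"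
  by (simp add: density_le_def)

text \<open>The class has at most \<open>n / m + 1\<close> elements below \<open>n\<close>. The
  extra 1 is absorbed for large \<open>n\<close> by the strict inequality between
  \<open>1 / m\<close> and \<open>e\<close>.\<close>

lemma density_le_residue_class:
  assumes "m > 0" "1 / real m < e"
  shows "density_le {n. n mod m = r} e"
proof -
  have pos: "e - 1 / real m > 0" using assms by simp
  obtain N :: nat where N: "real N > 1 / (e - 1 / real m)" using reals_Archimedean2 by blast
  have "real (card ({n. n mod m = r} \<inter> {..<n})) \<le> e * real n" if "n \<ge> N" for n
  proof -
    \<comment> \<open>With the remainder fixed, a number is determined by its quotient.\<close>
    have "card ({n. n mod m = r} \<inter> {..<n}) \<le> card {..n div m}"
    proof (rule card_inj_on_le[where f = "\<lambda>k. k div m"])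
      show "inj_on (\<lambda>k. k div m) ({n. n mod m = r} \<inter> {..<n})"
        by (rule inj_onI) (metis (mono_tags, lifting) IntD1 div_mult_mod_eq mem_Collect_eq)
    qed (auto intro: div_le_mono)
    then have "real (card ({n. n mod m = r} \<inter> {..<n})) \<le> real (n div m) + 1" by simp
    also have "real (n div m) \<le> real n / real m" by (rule of_nat_div_le_of_nat)
    also have "real n / real m + 1 \<le> e * real n"
    proof -
      have "1 / (e - 1 / real m) < real n" using N that by simp
      then have "1 < real n * (e - 1 / real m)" using pos by (simp only: pos_divide_less_eq)
      then show ?thesis by (simp add: algebra_simps)
    qed
    finally show ?thesis by simp
  qed
  then show ?thesis by (auto simp: density_le_def eventually_sequentially)
qed

text \<open>The residue classes modulo a large number are a finite partition of the naturals, so the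
  ultrafilter contains one of them.\<close>

lemma ultrafilter_contains_density_le:
  assumes "ultrafilter U" "e > 0"
  shows "\<exists>D. eventually (\<lambda>n. n \<in> D) U \<and> density_le D e"
proof -
  obtain k where k: "inverse (real (Suc k)) < e" using reals_Archimedean[OF assms(2)] by blast
  have "\<exists>r<Suc k. eventually (\<lambda>n. n mod Suc k = r) U"
  proof (rule ccontr)
    assume "\<not> ?thesis"
    then have "\<forall>r\<in>{..<Suc k}. eventually (\<lambda>n. n mod Suc k \<noteq> r) U"
      by (simp add: ultrafilter_not_eventually[OF assms(1)])
    then have "eventually (\<lambda>n. \<forall>r\<in>{..<Suc k}. n mod Suc k \<noteq> r) U"
      by (simp add: eventually_ball_finite)
    then have "eventually (\<lambda>n. False) U"
      by eventually_elim (metis lessThan_iff mod_less_divisor zero_less_Suc)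
    with assms(1) show False by (simp add: ultrafilter_def trivial_limit_def)
  qed
  then obtain r where "eventually (\<lambda>n. n mod Suc k = r) U" by blast
  moreover have "density_le {n. n mod Suc k = r} e"
    using k by (intro density_le_residue_class) (auto simp: inverse_eq_divide)
  ultimately show ?thesis by (intro exI[of _ "{n. n mod Suc k = r}"]) simp
qed

text \<open>Half of the budget \<open>e\<close> goes to the new ultrafilter and half to the
  induction hypothesis, hence the induction over arbitrary \<open>e\<close>.\<close>

lemma finite_ultrafilters_contain_density_le:
  assumes "finite X" "e > 0" "\<And>U. U \<in> X \<Longrightarrow> ultrafilter U"
  shows "\<exists>D. (\<forall>U\<in>X. eventually (\<lambda>n. n \<in> D) U) \<and> density_le D e"
  using assms
proof (induction X arbitrary: e rule: finite_induct)
  case empty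
  then show ?case by (intro exI[of _ "{}"]) (simp add: density_le_empty)
next
  case (insert U X)
  obtain D where D: "\<forall>V\<in>X. eventually (\<lambda>n. n \<in> D) V" "density_le D (e / 2)"
    using insert.IH[of "e / 2"] insert.prems by auto
  obtain D' where D': "eventually (\<lambda>n. n \<in> D') U" "density_le D' (e / 2)"
    using ultrafilter_contains_density_le[of U "e / 2"] insert.prems by auto
  have "density_le (D \<union> D') e" using density_le_Un[OF D(2) D'(2)] by simp
  moreover have "eventually (\<lambda>n. n \<in> D \<union> D') V" if "V \<in> insert U X" for V
    using that D(1) D'(1) by (auto elim: eventually_mono)
  ultimately show ?case by blast
qed

text \<open>Each \<open>A i\<close> enters only beyond a point from which it obeys the bound. Below
  \<open>n\<close>, the union then lies in the largest \<open>A j\<close> that has entered by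
  \<open>n\<close>, and that set satisfies the bound at \<open>n\<close>. \<open>A 0\<close> is kept
  whole so that the union contains it exactly.\<close>

lemma density_le_pseudo_union:
  fixes A :: "nat \<Rightarrow> nat set"
  assumes "incseq A" "\<And>i. density_le (A i) a"
  obtains k where "density_le (A 0 \<union> (\<Union>i. A i - {..<k i})) a"
proof -
  have "\<exists>K. \<forall>n\<ge>K. real (card (A i \<inter> {..<n})) \<le> a * real n" for i
    using assms(2)[of i] by (auto simp: density_le_def eventually_sequentially)
  then obtain K where K: "\<And>i n. n \<ge> K i \<Longrightarrow> real (card (A i \<inter> {..<n})) \<le> a * real n"
    by metis
  \<comment> \<open>The maximum gives \<open>k i >= K i\<close>. The summand \<open>i\<close> gives
    \<open>k i >= i\<close>, so only finitely many sets have entered by any given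
    \<open>n\<close>.\<close>
  define k where "k i = Max (K ` {..i}) + i" for i
  have kK: "k i \<ge> K i" and ki: "k i \<ge> i" for i
    unfolding k_def by (auto intro: trans_le_add1)
  have "real (card ((A 0 \<union> (\<Union>i. A i - {..<k i})) \<inter> {..<n})) \<le> a * real n" if n: "n \<ge> k 0" for n
  proof -
    define I where "I = {i. k i \<le> n}"
    have "I \<subseteq> {..n}" using ki order_trans by (auto simp: I_def)
    then have fin: "finite I" by (rule finite_subset) simp
    have "0 \<in> I" using n by (simp add: I_def)
    define j where "j = Max I"
    have "j \<in> I" using fin \<open>0 \<in> I\<close> unfolding j_def by (intro Max_in) auto
    have "(A 0 \<union> (\<Union>i. A i - {..<k i})) \<inter> {..<n} \<subseteq> A j \<inter> {..<n}"
    proof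
      fix x assume "x \<in> (A 0 \<union> (\<Union>i. A i - {..<k i})) \<inter> {..<n}"
      then obtain i where i: "x \<in> A i" "k i \<le> x \<or> i = 0" "x < n" by auto
      then have "i \<in> I" using \<open>0 \<in> I\<close> by (auto simp: I_def)
      then have "i \<le> j" using fin unfolding j_def by simp
      then show "x \<in> A j \<inter> {..<n}" using i assms(1) by (auto simp: incseq_def)
    qed
    then have "card ((A 0 \<union> (\<Union>i. A i - {..<k i})) \<inter> {..<n}) \<le> card (A j \<inter> {..<n})"
      by (intro card_mono) auto
    then have "real (card ((A 0 \<union> (\<Union>i. A i - {..<k i})) \<inter> {..<n})) \<le> real (card (A j \<inter> {..<n}))"
      by simp
    also have "\<dots> \<le> a * real n"
      using \<open>j \<in> I\<close> kK[of j] by (intro K) (simp add: I_def)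
    finally show ?thesis .
  qed
  then show thesis
    by (intro that[of k]) (auto simp: density_le_def eventually_sequentially)
qed

section \<open>Pointwise Borel sets are decided by sets of small density\<close>

text \<open>The pair \<open>(A, S)\<close> encodes the partial 0-1 function on \<open>A\<close> that
  is 1 exactly on the part of \<open>A\<close> in \<open>S\<close>. Its extensions are taken modulo
  finite sets, which \<open>clopen_ind\<close> cannot detect.\<close>

definition cylinder :: "nat set \<Rightarrow> nat set \<Rightarrow> nat set set" where
  "cylinder A S = {C. \<forall>\<^sub>F n in sequentially. n \<in> A \<longrightarrow> (n \<in> C \<longleftrightarrow> n \<in> S)}"

text \<open>In forcing terms, every condition \<open>(A, S)\<close> has a stronger one that decides
  membership in \<open>B\<close>, at an arbitrarily small cost \<open>b - a\<close> in density.
  Conditions extend each other exactly, not just modulo finite sets.\<close>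

definition density_decided :: "(omega_star \<Rightarrow>\<^sub>C real) set \<Rightarrow> bool" where
  "density_decided B \<longleftrightarrow> (\<forall>A S a b. density_le A a \<longrightarrow> a < b \<longrightarrow>
     (\<exists>A' S'. A \<subseteq> A' \<and> S' \<inter> A = S \<inter> A \<and> density_le A' b \<and>
        (clopen_ind ` cylinder A' S' \<subseteq> B \<or> clopen_ind ` cylinder A' S' \<inter> B = {})))"

lemma density_decidedE:
  assumes "density_decided B" "density_le A a" "a < b"
  obtains A' S' where "A \<subseteq> A'" "S' \<inter> A = S \<inter> A" "density_le A' b"
    "clopen_ind ` cylinder A' S' \<subseteq> B \<or> clopen_ind ` cylinder A' S' \<inter> B = {}"
  using assms(1)[unfolded density_decided_def, rule_format, OF assms(2,3), of S] that by metis

text \<open>A subbasic set restricts the value at one point. Agreement at finitely many points is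
  enough here, since indicators can be made to agree exactly.\<close>

lemma pointwise_open_finite_dependence:
  assumes "openin pointwise_topology B" "f \<in> B"
  shows "\<exists>X. finite X \<and> (\<forall>g. (\<forall>x\<in>X. apply_bcontfun g x = apply_bcontfun f x) \<longrightarrow> g \<in> B)"
proof -
  have "generate_topology_on {{f. apply_bcontfun f x \<in> U} | x U. open U} B"
    using assms(1) by (simp add: pointwise_topology_def openin_topology_generated_by)
  then show ?thesis using assms(2)
  proof (induction B rule: generate_topology_on.induct)
    case (Int a b)
    from Int.IH(1) Int.prems obtain X where
      X: "finite X" "\<forall>g. (\<forall>x\<in>X. apply_bcontfun g x = apply_bcontfun f x) \<longrightarrow> g \<in> a"
      by auto
    from Int.IH(2) Int.prems obtain Y where
      Y: "finite Y" "\<forall>g. (\<forall>x\<in>Y. apply_bcontfun g x = apply_bcontfun f x) \<longrightarrow> g \<in> b"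
      by auto
    from X Y show ?case by (intro exI[of _ "X \<union> Y"]) (simp add: ball_Un)
  next
    case (UN K)
    then obtain k where k: "k \<in> K" "f \<in> k" by auto
    from UN.IH[OF this] k(1) show ?case by (meson UnionI)
  next
    case (Basis s)
    then obtain x U where "s = {f. apply_bcontfun f x \<in> U}" by blast
    with Basis show ?case by (intro exI[of _ "{x}"]) auto
  qed simp
qed

text \<open>If some extension \<open>C\<close> lands in \<open>B\<close>, only its values at
  finitely many free ultrafilters matter. These share a set \<open>D\<close> of density at most
  \<open>b - a\<close>, and copying \<open>C\<close> on \<open>D\<close> forces all further
  extensions into \<open>B\<close>.\<close>

lemma density_decided_open:
  assumes B: "openin pointwise_topology B"
  shows "density_decided B"
  unfolding density_decided_def
proof (intro allI impI)
  fix A S a and b :: real assume A: "density_le A a" and ab: "a < b"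
  show "\<exists>A' S'. A \<subseteq> A' \<and> S' \<inter> A = S \<inter> A \<and> density_le A' b \<and>
      (clopen_ind ` cylinder A' S' \<subseteq> B \<or> clopen_ind ` cylinder A' S' \<inter> B = {})"
  proof (cases "clopen_ind ` cylinder A S \<inter> B = {}")
    case True
    then show ?thesis using density_le_mono[OF A, of b] ab by (intro exI[of _ A] exI[of _ S]) auto
  next
    case False
    then obtain C where C: "C \<in> cylinder A S" "clopen_ind C \<in> B" by blast
    obtain X where X: "finite X" "\<And>g. (\<forall>x\<in>X. apply_bcontfun g x = clopen_ind C x) \<Longrightarrow> g \<in> B"
      using pointwise_open_finite_dependence[OF B C(2)] by blast
    obtain D where D: "\<forall>U\<in>free_ultrafilter ` X. eventually (\<lambda>n. n \<in> D) U" "density_le D (b - a)"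
      using finite_ultrafilters_contain_density_le[of "free_ultrafilter ` X" "b - a"]
        X(1) ab ultrafilter_Rep by auto
    \<comment> \<open>\<open>C\<close> agrees with \<open>S\<close> on \<open>A\<close> only modulo
      a finite set, so on \<open>A\<close> the values come from \<open>S\<close> itself.\<close>
    define S' where "S' = (S \<inter> A) \<union> (C \<inter> D - A)"
    have "clopen_ind C' \<in> B" if C': "C' \<in> cylinder (A \<union> D) S'" for C'
    proof (rule X(2), rule ballI)
      fix x assume "x \<in> X"
      then have "eventually (\<lambda>n. n \<in> D) (free_ultrafilter x)" using D(1) by simp
      moreover have "eventually (\<lambda>n. n \<in> A \<union> D \<longrightarrow> (n \<in> C' \<longleftrightarrow> n \<in> S')) (free_ultrafilter x)"
        using C' by (intro eventually_free_ultrafilterI) (simp add: cylinder_def)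
      moreover have "eventually (\<lambda>n. n \<in> A \<longrightarrow> (n \<in> C \<longleftrightarrow> n \<in> S)) (free_ultrafilter x)"
        using C(1) by (intro eventually_free_ultrafilterI) (simp add: cylinder_def)
      ultimately have "eventually (\<lambda>n. n \<in> C' \<longleftrightarrow> n \<in> C) (free_ultrafilter x)"
        by eventually_elim (auto simp: S'_def)
      then have "eventually (\<lambda>n. n \<in> C') (free_ultrafilter x) \<longleftrightarrow>
          eventually (\<lambda>n. n \<in> C) (free_ultrafilter x)"
        by (rule eventually_cong)
      then show "clopen_ind C' x = clopen_ind C x" by (simp add: apply_clopen_ind)
    qed
    moreover have "density_le (A \<union> D) b" using density_le_Un[OF A D(2)] by simp
    moreover have "S' \<inter> A = S \<inter> A" by (auto simp: S'_def)
    ultimately show ?thesis by (intro exI[of _ "A \<union> D"] exI[of _ S']) auto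
  qed
qed

section \<open>Complements, countable unions and hence all Borel sets\<close>

lemma density_decided_Compl: "density_decided B \<Longrightarrow> density_decided (- B)"
proof -
  have "X \<subseteq> - B \<or> X \<inter> - B = {} \<longleftrightarrow> X \<subseteq> B \<or> X \<inter> B = {}" for X by blast
  then show "density_decided B \<Longrightarrow> density_decided (- B)"
    unfolding density_decided_def by simp
qed

text \<open>Unless some extension within the budget forces membership in one \<open>B i\<close>, the
  sets \<open>B i\<close> can be decided one after another, always negatively. An almost union of
  these conditions then avoids all of them.\<close>

lemma density_decided_UN:
  fixes B :: "nat \<Rightarrow> (omega_star \<Rightarrow>\<^sub>C real) set"
  assumes B: "\<And>i. density_decided (B i)"
  shows "density_decided (\<Union>i. B i)"
  unfolding density_decided_def
proof (intro allI impI)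
  fix A S a and b :: real assume A: "density_le A a" and ab: "a < b"
  define extends where "extends A' S' A S \<longleftrightarrow> A \<subseteq> A' \<and> S' \<inter> A = S \<inter> A"
    for A' S' A S :: "nat set"
  show "\<exists>A' S'. A \<subseteq> A' \<and> S' \<inter> A = S \<inter> A \<and> density_le A' b \<and>
      (clopen_ind ` cylinder A' S' \<subseteq> (\<Union>i. B i) \<or> clopen_ind ` cylinder A' S' \<inter> (\<Union>i. B i) = {})"
  proof (cases "\<exists>A' S' i. extends A' S' A S \<and> density_le A' b \<and> clopen_ind ` cylinder A' S' \<subseteq> B i")
    case True
    then show ?thesis unfolding extends_def by blast
  next
    case False
    \<comment> \<open>The bound \<open>c\<close> stays strictly below \<open>b\<close>, which leaves
      room for the next decision.\<close>
    define good where "good p \<longleftrightarrow> extends (fst p) (snd p) A S \<and> (\<exists>c<b. density_le (fst p) c)"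
      for p :: "nat set \<times> nat set"
    have "\<exists>p. \<forall>i. good (p i) \<and> (extends (fst (p (Suc i))) (snd (p (Suc i))) (fst (p i)) (snd (p i)) \<and>
        clopen_ind ` cylinder (fst (p (Suc i))) (snd (p (Suc i))) \<inter> B i = {})"
    proof (rule dependent_nat_choice)
      show "\<exists>p. good p" using A ab by (intro exI[of _ "(A, S)"]) (auto simp: good_def extends_def)
    next
      fix p i assume p: "good p"
      then obtain c where c: "c < b" "density_le (fst p) c" by (auto simp: good_def)
      \<comment> \<open>Each decision spends half of the remaining room.\<close>
      define d where "d = (b + c) / 2"
      have d: "c < d" "d < b" using c(1) by (auto simp: d_def)
      obtain A' S' where A': "extends A' S' (fst p) (snd p)" "density_le A' d"
        "clopen_ind ` cylinder A' S' \<subseteq> B i \<or> clopen_ind ` cylinder A' S' \<inter> B i = {}"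
        using B[of i] c(2) d(1) unfolding density_decided_def extends_def by metis
      have ext: "extends A' S' A S" using A'(1) p unfolding good_def extends_def by blast
      have "density_le A' b" using A'(2) d(2) density_le_mono by fastforce
      with False ext A'(3) have "clopen_ind ` cylinder A' S' \<inter> B i = {}" by blast
      with ext A'(1,2) d(2)
      show "\<exists>q. good q \<and> (extends (fst q) (snd q) (fst p) (snd p) \<and>
          clopen_ind ` cylinder (fst q) (snd q) \<inter> B i = {})"
        by (intro exI[of _ "(A', S')"]) (auto simp: good_def)
    qed
    then obtain p where p: "\<And>i. good (p i)"
        "\<And>i. extends (fst (p (Suc i))) (snd (p (Suc i))) (fst (p i)) (snd (p i))"
        "\<And>i. clopen_ind ` cylinder (fst (p (Suc i))) (snd (p (Suc i))) \<inter> B i = {}"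
      by blast
    define P where "P i = fst (p i)" for i
    define T where "T i = snd (p i)" for i
    have ext: "extends (P j) (T j) (P i) (T i)" if "i \<le> j" for i j
      using that
    proof (induction rule: dec_induct)
      case base
      show ?case by (simp add: extends_def)
    next
      case (step j)
      with p(2)[of j] show ?case unfolding extends_def P_def T_def by blast
    qed
    have inc: "incseq P" using ext by (auto simp: incseq_def extends_def)
    have dens: "density_le (P i) b" for i
      using p(1)[of i] density_le_mono less_imp_le unfolding good_def P_def by blast
    obtain k where k: "density_le (P 0 \<union> (\<Union>i. P i - {..<k i})) b"
      using density_le_pseudo_union[OF inc dens] by blast
    define P' where "P' = P 0 \<union> (\<Union>i. P i - {..<k i})"
    \<comment> \<open>The partial functions cohere, so they have a common union; \<open>P'\<close>
      is its domain up to the removed initial segments.\<close>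
    define T' where "T' = (\<Union>i. T i \<inter> P i)"
    have T': "n \<in> T' \<longleftrightarrow> n \<in> T i" if n: "n \<in> P i" for n i
    proof -
      have "n \<in> T j \<inter> P j \<longrightarrow> n \<in> T i" for j
        using ext[of i j] ext[of j i] n unfolding extends_def by (cases "i \<le> j") auto
      then show ?thesis using n unfolding T'_def by blast
    qed
    have "A \<subseteq> P 0" "T 0 \<inter> A = S \<inter> A"
      using p(1)[of 0] by (auto simp: good_def extends_def P_def T_def)
    then have "A \<subseteq> P'" "T' \<inter> A = S \<inter> A"
      using T'[of _ 0] by (auto simp: P'_def)
    moreover have "density_le P' b" using k by (simp add: P'_def)
    \<comment> \<open>Only elements of \<open>P i\<close> below \<open>k i\<close> can be missing
      from \<open>P'\<close>, and cylinders ignore finitely many exceptions.\<close>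
    moreover have sub: "cylinder P' T' \<subseteq> cylinder (P i) (T i)" for i
    proof
      fix C assume "C \<in> cylinder P' T'"
      then have "\<forall>\<^sub>F n in sequentially. n \<in> P' \<longrightarrow> (n \<in> C \<longleftrightarrow> n \<in> T')"
        by (simp add: cylinder_def)
      then have "\<forall>\<^sub>F n in sequentially. n \<in> P i \<longrightarrow> (n \<in> C \<longleftrightarrow> n \<in> T i)"
        using eventually_ge_at_top[of "k i"]
      proof eventually_elim
        case (elim n)
        show ?case
        proof
          assume n: "n \<in> P i"
          then have "n \<in> P i - {..<k i}" using elim(2) by simp
          then have "n \<in> P'" unfolding P'_def by blast
          with elim(1) T'[OF n] show "n \<in> C \<longleftrightarrow> n \<in> T i" by simp
        qed
      qed
      then show "C \<in> cylinder (P i) (T i)" by (simp add: cylinder_def)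
    qed
    \<comment> \<open>Stage \<open>Suc i\<close> is the one that decides \<open>B i\<close>.\<close>
    have "clopen_ind ` cylinder P' T' \<inter> B i = {}" for i
      using image_mono[OF sub[of "Suc i"], of clopen_ind] p(3)[of i] unfolding P_def T_def by blast
    then have "clopen_ind ` cylinder P' T' \<inter> (\<Union>i. B i) = {}" by blast
    ultimately show ?thesis by blast
  qed
qed

lemma density_decided_borel:
  assumes "B \<in> borel_sets pointwise_topology"
  shows "density_decided B"
proof -
  have top: "topspace (pointwise_topology :: (omega_star \<Rightarrow>\<^sub>C real) topology) = UNIV"
    unfolding pointwise_topology_def topology_generated_by_topspace by (auto intro: exI[of _ UNIV])
  show ?thesis using assms unfolding borel_sets_def top
  proof (induction rule: sigma_sets.induct)
    case (Basic B)
    then show ?case by (simp add: density_decided_open)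
  next
    case Empty
    show ?case by (simp add: density_decided_open)
  next
    case (Compl B)
    then show ?case by (simp add: density_decided_Compl Compl_eq_Diff_UNIV[symmetric])
  next
    case (Union B)
    then show ?case by (simp add: density_decided_UN)
  qed
qed

section \<open>A weakly open half-space that is not decided\<close>

theorem mainTheorem2:
  shows "borel_sets (pointwise_topology :: (omega_star \<Rightarrow>\<^sub>C real) topology) \<noteq>
         borel_sets (weak_topology :: (omega_star \<Rightarrow>\<^sub>C real) topology)"
proof
  assume eq: "borel_sets (pointwise_topology :: (omega_star \<Rightarrow>\<^sub>C real) topology) =
    borel_sets (weak_topology :: (omega_star \<Rightarrow>\<^sub>C real) topology)"
  obtain U :: "nat filter" where U: "ultrafilter U" "U \<le> sequentially"
    using ultrafilter_below[of sequentially] by auto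
  define B where "B = density_functional U -` {1/2<..}"
  have "openin weak_topology B"
    unfolding weak_topology_def B_def
    using bounded_linear_density_functional[OF U] open_greaterThan
    by (intro topology_generated_by_Basis) blast
  then have "B \<in> borel_sets pointwise_topology"
    unfolding eq by (auto simp: borel_sets_def)
  then have "density_decided B" by (rule density_decided_borel)
  \<comment> \<open>Starting from the empty condition, the budget 1/4 puts the two values below at
    most 1/4 and at least 3/4, on either side of 1/2.\<close>
  then obtain A S where A: "density_le A (1/4)"
    "clopen_ind ` cylinder A S \<subseteq> B \<or> clopen_ind ` cylinder A S \<inter> B = {}"
    by (rule density_decidedE[where A = "{}" and a = 0 and b = "1/4"])
      (simp_all add: density_le_empty)
  \<comment> \<open>These are the least extension, 0 off \<open>A\<close>, and the complement of the
    greatest one, 1 off \<open>A\<close>.\<close>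
  have small: "density_le (S \<inter> A) (1/4)" "density_le (- (S \<union> - A)) (1/4)"
    by (rule density_le_subset[OF A(1)]; blast)+
  have "S \<inter> A \<in> cylinder A S" "S \<union> - A \<in> cylinder A S" by (auto simp: cylinder_def)
  moreover have "clopen_ind (S \<inter> A) \<notin> B"
    using density_functional_le[OF U small(1)] by (simp add: B_def)
  moreover have "clopen_ind (S \<union> - A) \<in> B"
    using density_functional_ge[OF U small(2)] by (simp add: B_def)
  ultimately show False using A(2) by blast
qed

end
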